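(* Let $d\ge 1$, $\lambda \ge 0$, $Z \in \mathbb{R}^{d\times 2}$, and let $X^* \in \mathbb{R}^{d\times 2}$ be a solution of the proximal step $\min_{X\in\mathbb{R}^{d\times 2}} \frac12\|X - Z\|_F^2 + \lambda\|X\|_{1\text{-}(2,1)}$. Let $x^i, z^i\in\mathbb{R}^2$ denote the $i$th rows of $X^*$ and $Z$, respectively. Then for every $i = 1,\dots,d$, $x^i$ is a solution of the proximal step of $\lambda\|\cdot\|_{1\text{-}2}$ at $z^i$, i.e. $x^i \in \arg\min_{x\in\mathbb{R}^2} \frac12\|x - z^i\|_2^2 + \lambda\left(\|x\|_1 - \|x\|_2\right)$.
   Context: For $X\in\mathbb{R}^{d\times 2}$: $\|X\|_1 = \sum_{i,j}|X_{ij}|$, $\|X\|_{2,1} = \sum_{i=1}^d \left(\sum_{j=1}^2 X_{ij}^2\right)^{1/2}$ is the sum of the Euclidean norms of the rows, $\|X\|_{1\text{-}(2,1)} = \|X\|_1 - \|X\|_{2,1}$, and $\|X\|_F$ is the Frobenius norm. For a vector $x$, $\|x\|_{1\text{-}2} = \|x\|_1 - \|x\|_2$. For a function $g$, $\operatorname{prox}_{\lambda g}(z) = \arg\min_x \frac12\|x-z\|^2 + \lambda g(x)$ (Euclidean, respectively Frobenius, norm). *)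

theory Defs
  imports "HOL-Analysis.Analysis"
begin

definition vec_norm_1 :: "real ^ 'n \<Rightarrow> real" where
  "vec_norm_1 x = (\<Sum>j\<in>UNIV. \<bar>x $ j\<bar>)"

definition vec_norm_1_2 :: "real ^ 'n \<Rightarrow> real" where
  "vec_norm_1_2 x = vec_norm_1 x - norm x"

definition mat_norm_1 :: "real ^ 2 ^ 'd \<Rightarrow> real" where
  "mat_norm_1 X = (\<Sum>i\<in>UNIV. \<Sum>j\<in>UNIV. \<bar>X $ i $ j\<bar>)"

definition mat_norm_21 :: "real ^ 2 ^ 'd \<Rightarrow> real" where
  "mat_norm_21 X = (\<Sum>i\<in>UNIV. sqrt (\<Sum>j\<in>UNIV. (X $ i $ j)\<^sup>2))"

definition mat_norm_1_21 :: "real ^ 2 ^ 'd \<Rightarrow> real" where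
  "mat_norm_1_21 X = mat_norm_1 X - mat_norm_21 X"

(* Set-valued, since the objectives considered are not convex. The norm is that of the type:
   Euclidean on real ^ 'n, Frobenius on real ^ 'n ^ 'd (see norm_matrix_eq_Frobenius). *)
definition prox :: "real \<Rightarrow> ('a::real_normed_vector \<Rightarrow> real) \<Rightarrow> 'a \<Rightarrow> 'a set" where
  "prox lam g z = {x. is_arg_min (\<lambda>x. 1 / 2 * (norm (x - z))\<^sup>2 + lam * g x) (\<lambda>x. x \<in> UNIV) x}"

lemma norm_matrix_eq_Frobenius:
  fixes X :: "real ^ 'n ^ 'd"
  shows "norm X = sqrt (\<Sum>i\<in>UNIV. \<Sum>j\<in>UNIV. (X $ i $ j)\<^sup>2)"
  by (simp add: norm_vec_def L2_set_def sum_nonneg)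

end

(* The matrix objective is the sum over the rows of the vector objectives, so replacing a single
   row of a minimiser changes only the summand of that row, which must therefore be minimal. *)
theory Submission
  imports Defs
begin

text \<open>The proximal problem decouples: the squared Frobenius distance
  (\<open>norm_squared_eq_sum_rows\<close>) and the penalty
  (\<open>mat_norm_1_21_eq_sum_rows\<close>) are both sums of one term per row. Then
  \<open>nth_mem_prox_of_separable\<close> passes minimality on to each row.\<close>

lemma row_eq_nth: "row i A = A $ i"
  by (simp add: row_def)

lemma norm_squared_eq_sum_rows:
  fixes X :: "'a::real_normed_vector ^ 'd"
  shows "(norm X)\<^sup>2 = (\<Sum>i\<in>UNIV. (norm (X $ i))\<^sup>2)"
  by (simp add: norm_vec_def L2_set_def sum_nonneg)

lemma mat_norm_1_21_eq_sum_rows: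
  "mat_norm_1_21 X = (\<Sum>i\<in>UNIV. vec_norm_1_2 (X $ i))"
  by (simp add: mat_norm_1_21_def mat_norm_1_def mat_norm_21_def vec_norm_1_2_def
      vec_norm_1_def norm_vec_def L2_set_def sum_subtractf)

text \<open>\<open>is_arg_min\<close> forbids strictly smaller values; since the reals are totally
  ordered, this is an inequality against every competitor.\<close>

lemma mem_prox_iff:
  "x \<in> prox lam g z \<longleftrightarrow>
    (\<forall>y. 1 / 2 * (norm (x - z))\<^sup>2 + lam * g x \<le> 1 / 2 * (norm (y - z))\<^sup>2 + lam * g y)"
  by (auto simp: prox_def is_arg_min_def not_less)

text \<open>A global minimiser is tested only against matrices that differ from it in row
  \<open>i\<close>, so the argument covers nonconvex \<open>g\<close>.\<close>

lemma nth_mem_prox_of_separable: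
  fixes X Z :: "'a::real_normed_vector ^ 'd"
  assumes sep: "\<And>Y. G Y = (\<Sum>i\<in>UNIV. g (Y $ i))"
    and X: "X \<in> prox lam G Z"
  shows "X $ i \<in> prox lam g (Z $ i)"
  unfolding mem_prox_iff
proof
  fix y
  define f where "f k x = 1 / 2 * (norm (x - Z $ k))\<^sup>2 + lam * g x" for k x
  define Y where "Y = (\<chi> k. if k = i then y else X $ k)"
  \<comment> \<open>Isolates the summand of row \<open>i\<close>; the remaining sum is the same for
    \<open>X\<close> and \<open>Y\<close> and cancels when the two objectives are compared.\<close>
  have split: "1 / 2 * (norm (W - Z))\<^sup>2 + lam * G W = f i (W $ i) + (\<Sum>k\<in>-{i}. f k (W $ k))" for W
  proof -
    have "1 / 2 * (norm (W - Z))\<^sup>2 + lam * G W = (\<Sum>k\<in>UNIV. f k (W $ k))"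
      unfolding sep norm_squared_eq_sum_rows f_def
      by (simp add: sum.distrib sum_distrib_left)
    then show ?thesis
      by (simp add: sum.remove[of UNIV i] Compl_eq_Diff_UNIV)
  qed
  have "(\<Sum>k\<in>-{i}. f k (Y $ k)) = (\<Sum>k\<in>-{i}. f k (X $ k))"
    by (rule sum.cong) (auto simp: Y_def)
  moreover have "Y $ i = y"
    by (simp add: Y_def)
  ultimately have "f i (X $ i) \<le> f i y"
    using X[unfolded mem_prox_iff, rule_format, of Y] unfolding split by simp
  then show "1 / 2 * (norm (X $ i - Z $ i))\<^sup>2 + lam * g (X $ i)
      \<le> 1 / 2 * (norm (y - Z $ i))\<^sup>2 + lam * g y"
    by (simp add: f_def)
qed

theorem mainTheorem3:
  fixes X Z :: "real ^ 2 ^ 'd" and lam :: real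
  assumes "lam \<ge> 0"
    and "X \<in> prox lam mat_norm_1_21 Z"
  shows "\<forall>i. row i X \<in> prox lam vec_norm_1_2 (row i Z)"
  unfolding row_eq_nth
  using nth_mem_prox_of_separable[OF mat_norm_1_21_eq_sum_rows assms(2)] by blast

end
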